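(* Let $\theta\in(0,1]$, $r=1$, and let $\{Z_n\}_{n\ge0}$ be a GW$^{\,\theta}$-process with parameters $(\theta,1,a_n,c_n)_{n\ge1}$. Suppose $C=\lim_{n\to\infty}C_n=\infty$ and $B_n\to\infty$. Then $q=1$, $$\mathrm{P}(Z_n>0)\sim C_n^{-1/\theta},\qquad \mathrm{E}(Z_n|Z_n>0)\sim B_n^{1/\theta},$$ and with $\lambda_n=\lambda B_n^{-1/\theta}$, $$\mathrm{E}(e^{-\lambda_nZ_n}|Z_n>0)\to1-(1+\lambda^{-\theta})^{-1/\theta},\quad \lambda\ge0.$$
   Context: All limits and asymptotic equivalences are as $n\to\infty$. Let $\theta\in(0,1]$, $r=1$, and let $(a_n,c_n)_{n\ge1}$ be real sequences with $0<a_n<\infty$, $c_n>0$, $c_n\ge 1-a_n$ for all $n\ge1$. Put $$f_n(s)=1-(a_n(1-s)^{-\theta}+c_n)^{-1/\theta},\quad 0\le s<1,\qquad f_n(1)=1.$$ Each $f_n(s)=\sum_{j\ge0}p_n(j)s^j$ is a probability generating function. The GW$^{\,\theta}$-process with parameters $(\theta,1,a_n,c_n)_{n\ge1}$ is the Galton-Watson process in a varying environment $\{Z_n\}_{n\ge0}$ with $Z_0=1$, $Z_n=\sum_{i=1}^{Z_{n-1}}X_{n,i}$, where $\{X_{n,i}\}_{n,i\ge1}$ are independent and $\mathrm{P}(X_{n,i}=j)=p_n(j)$. Thus $\mathrm{E}(s^{Z_n})=f_1\circ\cdots\circ f_n(s)$. The extinction probability is $q=\lim \mathrm{P}(Z_n=0)$.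 Notation: $A_0=1$, $A_n=\prod_{i=1}^n a_i$, $C_n=\sum_{i=1}^n A_{i-1}c_i$, $B_n=C_n/A_n$, $C=\lim C_n\in(0,\infty]$. Conventions: $0^{-\theta}=\infty$, $\infty^{-1/\theta}=0$. *)

theory Defs
  imports "HOL-Probability.Probability" "HOL-Library.Landau_Symbols"
begin

definition gw_theta_pgf :: "real \<Rightarrow> real \<Rightarrow> real \<Rightarrow> real \<Rightarrow> real" where
  "gw_theta_pgf \<theta> a c s =
     (if s < 1 then 1 - (a * (1 - s) powr (-\<theta>) + c) powr (-(1 / \<theta>)) else 1)"

text \<open>\<open>X n i\<close> is the number of children of the \<open>i\<close>-th individual of generation \<open>n - 1\<close>;
  only indices \<open>n, i \<ge> 1\<close> are used.\<close>

primrec gwve :: "(nat \<Rightarrow> nat \<Rightarrow> 'w \<Rightarrow> nat) \<Rightarrow> nat \<Rightarrow> 'w \<Rightarrow> nat" where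
  "gwve X 0 \<omega> = 1"
| "gwve X (Suc n) \<omega> = (\<Sum>i = 1..gwve X n \<omega>. X (Suc n) i \<omega>)"

text \<open>The offspring laws \<open>p n\<close> are determined by their generating functions
  \<open>gw_theta_pgf \<theta> (a n) (c n)\<close>; at \<open>s = 1\<close> the generating function identity says that
  \<open>p n\<close> has total mass 1.\<close>

locale gw_theta_process = prob_space M
  for M :: "'w measure" +
  fixes \<theta> :: real and a c :: "nat \<Rightarrow> real"
    and p :: "nat \<Rightarrow> nat \<Rightarrow> real"
    and X :: "nat \<Rightarrow> nat \<Rightarrow> 'w \<Rightarrow> nat"
  assumes theta: "0 < \<theta>" "\<theta> \<le> 1"
    and a_pos: "\<And>n. n \<ge> 1 \<Longrightarrow> 0 < a n"
    and c_pos: "\<And>n. n \<ge> 1 \<Longrightarrow> 0 < c n"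
    and c_ge: "\<And>n. n \<ge> 1 \<Longrightarrow> c n \<ge> 1 - a n"
    and p_nonneg: "\<And>n j. n \<ge> 1 \<Longrightarrow> 0 \<le> p n j"
    and pgf: "\<And>n s. \<lbrakk>n \<ge> 1; 0 \<le> s; s \<le> 1\<rbrakk> \<Longrightarrow>
                (\<lambda>j. p n j * s ^ j) sums gw_theta_pgf \<theta> (a n) (c n) s"
    and indep: "indep_vars (\<lambda>_. count_space UNIV) (\<lambda>(n, i). X n i) ({1..} \<times> {1..})"
    and law: "\<And>n i j. \<lbrakk>n \<ge> 1; i \<ge> 1\<rbrakk> \<Longrightarrow> \<P>(\<omega> in M. X n i \<omega> = j) = p n j"

definition A_seq :: "(nat \<Rightarrow> real) \<Rightarrow> nat \<Rightarrow> real" where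
  "A_seq a n = (\<Prod>i = 1..n. a i)"

definition C_seq :: "(nat \<Rightarrow> real) \<Rightarrow> (nat \<Rightarrow> real) \<Rightarrow> nat \<Rightarrow> real" where
  "C_seq a c n = (\<Sum>i = 1..n. A_seq a (i - 1) * c i)"

definition B_seq :: "(nat \<Rightarrow> real) \<Rightarrow> (nat \<Rightarrow> real) \<Rightarrow> nat \<Rightarrow> real" where
  "B_seq a c n = C_seq a c n / A_seq a n"

text \<open>Conditional expectation \<open>E(Y | A)\<close> given an event \<open>A\<close>. The Bochner integral of a
  non-integrable function is 0, so for \<open>Y \<ge> 0\<close> a nonzero value entails that \<open>Y\<close> is integrable
  on \<open>A\<close>.\<close>

definition cond_expectation :: "'w measure \<Rightarrow> ('w \<Rightarrow> real) \<Rightarrow> 'w set \<Rightarrow> real" where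
  "cond_expectation M Y A = (LINT \<omega>:A|M. Y \<omega>) / measure M A"

text \<open>\<open>1 - (1 + u powr -\<theta>) powr (-1/\<theta>)\<close> for \<open>u \<ge> 0\<close> with the conventions that \<open>0\<close> to the
  power \<open>-\<theta>\<close> is \<open>\<infinity>\<close> and \<open>\<infinity>\<close> to the power \<open>-1/\<theta>\<close> is \<open>0\<close>, so that the value at \<open>u = 0\<close>
  is 1. The case distinction is needed because \<^term>\<open>(0::real) powr x = 0\<close>.\<close>

definition limit_laplace :: "real \<Rightarrow> real \<Rightarrow> real" where
  "limit_laplace \<theta> u =
     1 - (if u = 0 then 0 else (1 + u powr (-\<theta>)) powr (-(1 / \<theta>)))"

end

theory Submission
  imports Defs "HOL-Real_Asymp.Real_Asymp"
begin

text \<open>With \<open>A n\<close>, \<open>C n\<close> as in the paper, the maps \<open>f n\<close> act on \<open>x = (1 - s) powr -\<theta>\<close> as the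
  affine maps \<open>a n * x + c n\<close>, so their composition is the map of the same family with parameters
  \<open>A n\<close>, \<open>C n\<close>. Hence the generating function of \<open>Z n\<close> is explicit: its value at \<open>0\<close> gives the
  survival probability \<open>(A n + C n) powr (-1/\<theta>)\<close>, its slope at \<open>1\<close> gives the mean
  \<open>A n powr (-1/\<theta>)\<close>, and its value at \<open>exp (- \<lambda> n)\<close> gives the conditional Laplace transform.\<close>

section \<open>Generating functions of the family\<close>

lemma gw_theta_pgf_less_1:
  assumes "0 < a" "0 \<le> c" "s < 1"
  shows "gw_theta_pgf \<theta> a c s < 1"
proof -
  have "a * (1 - s) powr (-\<theta>) + c > 0" using assms by (simp add: add_pos_nonneg)
  then show ?thesis using assms by (simp add: gw_theta_pgf_def)
qed

text \<open>For \<open>s < 1\<close> the factor \<open>(1 - s) powr (-\<theta>)\<close> is at least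
  1, so the base is at least \<open>a + c\<close>, hence at least 1, and its negative power is at
  most 1. This keeps iterated arguments inside the domain of the generating functions.\<close>

lemma gw_theta_pgf_nonneg:
  assumes "0 < \<theta>" "0 < a" "1 - a \<le> c" "0 \<le> s"
  shows "0 \<le> gw_theta_pgf \<theta> a c s"
proof (cases "s < 1")
  case True
  have "1 \<le> (1 - s) powr (-\<theta>)"
    using True assms powr_mono2'[of "-\<theta>" "1 - s" 1] by simp
  then have "a * 1 \<le> a * (1 - s) powr (-\<theta>)"
    using assms by (intro mult_left_mono) auto
  then have "1 \<le> a * (1 - s) powr (-\<theta>) + c" using assms by linarith
  then have "(a * (1 - s) powr (-\<theta>) + c) powr (-(1/\<theta>)) \<le> 1"
    using assms powr_mono2'[of "-(1/\<theta>)" 1 "a * (1 - s) powr (-\<theta>) + c"] by simp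
  then show ?thesis using True by (simp add: gw_theta_pgf_def)
qed (simp add: gw_theta_pgf_def)

text \<open>The inner base is positive, so the outer power \<open>-\<theta>\<close> undoes the inner
  power \<open>-1/\<theta>\<close> and only affine maps are composed. The inner value lies below 1,
  which selects the regular branch of the outer map.\<close>

lemma gw_theta_pgf_comp:
  assumes "\<theta> \<noteq> 0" "0 < a'" "0 \<le> c'" "s < 1"
  shows "gw_theta_pgf \<theta> a c (gw_theta_pgf \<theta> a' c' s) = gw_theta_pgf \<theta> (a * a') (c + a * c') s"
proof -
  have "a' * (1 - s) powr (-\<theta>) + c' > 0" using assms by (simp add: add_pos_nonneg)
  then have "(1 - gw_theta_pgf \<theta> a' c' s) powr (-\<theta>) = a' * (1 - s) powr (-\<theta>) + c'"
    using assms by (simp add: gw_theta_pgf_def powr_powr)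
  then show ?thesis
    using gw_theta_pgf_less_1[of a' c' s \<theta>] assms
    by (simp add: gw_theta_pgf_def[of \<theta> a c] gw_theta_pgf_def[of \<theta> "a * a'"] algebra_simps)
qed

lemma A_seq_0 [simp]: "A_seq a 0 = 1" and A_seq_Suc: "A_seq a (Suc n) = A_seq a n * a (Suc n)"
  by (simp_all add: A_seq_def)

lemma C_seq_0 [simp]: "C_seq a c 0 = 0"
  and C_seq_Suc: "C_seq a c (Suc n) = C_seq a c n + A_seq a n * c (Suc n)"
  by (simp_all add: C_seq_def)

section \<open>Branching\<close>

text \<open>The partial sum over \<open>k < m\<close> is \<open>Y\<close> cut off to the event
  \<open>N < m\<close>; these cut-offs are dominated by the absolute value of \<open>Y\<close> and
  converge to \<open>Y\<close>. It serves to condition on an offspring count or a generation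
  size.\<close>

lemma (in prob_space) integral_disintegrate_sums:
  fixes Y :: "'a \<Rightarrow> real" and N :: "'a \<Rightarrow> nat"
  assumes Y: "integrable M Y" and N [measurable]: "N \<in> measurable M (count_space UNIV)"
  shows "(\<lambda>k. expectation (\<lambda>\<omega>. indicator {k} (N \<omega>) * Y \<omega>)) sums expectation Y"
proof -
  have [measurable]: "Y \<in> borel_measurable M" using Y by simp
  have int: "integrable M (\<lambda>\<omega>. indicator {k} (N \<omega>) * Y \<omega>)" for k
    by (rule Bochner_Integration.integrable_bound[OF Y]) (auto simp: indicator_def)
  have sum_eq: "(\<Sum>k<m. indicator {k} (N \<omega>) * Y \<omega>) = (if N \<omega> < m then Y \<omega> else 0)" for m \<omega>
    by (simp add: indicator_def if_distrib[of "\<lambda>x. x * _"] sum.delta' cong: if_cong)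
  have "(\<lambda>m. expectation (\<lambda>\<omega>. \<Sum>k<m. indicator {k} (N \<omega>) * Y \<omega>)) \<longlonglongrightarrow> expectation Y"
  proof (rule integral_dominated_convergence[where w = "\<lambda>\<omega>. \<bar>Y \<omega>\<bar>"])
    show "AE \<omega> in M. (\<lambda>m. \<Sum>k<m. indicator {k} (N \<omega>) * Y \<omega>) \<longlonglongrightarrow> Y \<omega>"
    proof (rule AE_I2)
      fix \<omega>
      have "\<forall>\<^sub>F m in sequentially. Y \<omega> = (if N \<omega> < m then Y \<omega> else 0)"
        using eventually_gt_at_top[of "N \<omega>"] by eventually_elim simp
      then show "(\<lambda>m. \<Sum>k<m. indicator {k} (N \<omega>) * Y \<omega>) \<longlonglongrightarrow> Y \<omega>"
        unfolding sum_eq by (rule Lim_transform_eventually[OF tendsto_const])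
    qed
  qed (use Y in \<open>auto simp: sum_eq\<close>)
  then show ?thesis
    unfolding sums_def by (subst (asm) Bochner_Integration.integral_sum) (rule int)
qed

text \<open>The two families may live on different spaces, so that the process can be evaluated on a
  table of counts in place of a sample point.\<close>

lemma gwve_cong:
  assumes "\<And>m i. 1 \<le> m \<Longrightarrow> m \<le> n \<Longrightarrow> 1 \<le> i \<Longrightarrow> X m i \<omega> = Y m i \<eta>"
  shows "gwve X n \<omega> = gwve Y n \<eta>"
  using assms by (induction n) auto

text \<open>Stated for arbitrary families because it is also applied to coordinate maps on a product
  space. The random number of summands is handled by splitting over its countably many
  values.\<close>

lemma measurable_gwve:
  assumes "\<And>m i. 1 \<le> m \<Longrightarrow> m \<le> n \<Longrightarrow> 1 \<le> i \<Longrightarrow> X m i \<in> measurable M (count_space UNIV)"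
  shows "gwve X n \<in> measurable M (count_space UNIV)"
  using assms
proof (induction n)
  case 0
  have "gwve X 0 = (\<lambda>_. 1)" by auto
  then show ?case by simp
next
  case (Suc n)
  have "(\<lambda>\<omega>. \<Sum>i = 1..k. X (Suc n) i \<omega>) \<in> measurable M (count_space UNIV)" for k
    using Suc.prems by (induction k) auto
  moreover have "gwve X n \<in> measurable M (count_space UNIV)" using Suc by simp
  ultimately show ?case
    using measurable_compose_countable[of "\<lambda>k \<omega>. \<Sum>i = 1..k. X (Suc n) i \<omega>" M "count_space UNIV" "gwve X n"]
    by simp
qed

context gw_theta_process
begin

lemma X_measurable:
  "n \<ge> 1 \<Longrightarrow> i \<ge> 1 \<Longrightarrow> X n i \<in> measurable M (count_space UNIV)"
  using indep by (auto simp: indep_vars_def)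

lemma gwve_measurable [measurable]: "gwve X n \<in> measurable M (count_space UNIV)"
  by (rule measurable_gwve) (rule X_measurable)

lemma integrable_power:
  fixes s :: real
  assumes "N \<in> measurable M (count_space UNIV)" "0 \<le> s" "s \<le> 1"
  shows "integrable M (\<lambda>\<omega>. s ^ N \<omega>)"
  using assms by (intro integrable_const_bound[where B = 1]) (auto simp: power_le_one)

lemma expectation_power_offspring:
  assumes "n \<ge> 1" "i \<ge> 1" "0 \<le> s" "s \<le> 1"
  shows "expectation (\<lambda>\<omega>. s ^ X n i \<omega>) = gw_theta_pgf \<theta> (a n) (c n) s"
proof -
  note [measurable] = X_measurable[OF assms(1,2)]
  have "expectation (\<lambda>\<omega>. indicator {j} (X n i \<omega>) * s ^ X n i \<omega>) = p n j * s ^ j" for j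
  proof -
    have "expectation (\<lambda>\<omega>. indicator {j} (X n i \<omega>) * s ^ X n i \<omega>)
        = expectation (\<lambda>\<omega>. indicator {\<omega> \<in> space M. X n i \<omega> = j} \<omega> * s ^ j)"
      by (intro Bochner_Integration.integral_cong) (auto simp: indicator_def)
    also have "\<dots> = p n j * s ^ j" using law[OF assms(1,2)] by simp
    finally show ?thesis .
  qed
  then have "(\<lambda>j. p n j * s ^ j) sums expectation (\<lambda>\<omega>. s ^ X n i \<omega>)"
    using integral_disintegrate_sums[OF integrable_power, of "X n i" s "X n i"] assms by simp
  then show ?thesis using pgf[OF assms(1,3,4)] by (rule sums_unique2)
qed

text \<open>Generation \<open>n\<close> is a function of the counts of generations up to
  \<open>n\<close>, which are independent of those of generation \<open>Suc n\<close>, so the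
  expectation factors. With \<open>k\<close> fixed the product has a deterministic number of
  factors.\<close>

lemma expectation_power_sum_on_gwve_eq:
  assumes s: "0 \<le> s" "s \<le> 1"
  shows "expectation (\<lambda>\<omega>. indicator {k} (gwve X n \<omega>) * (\<Prod>i = 1..k. s ^ X (Suc n) i \<omega>))
    = expectation (\<lambda>\<omega>. indicator {k} (gwve X n \<omega>)) * gw_theta_pgf \<theta> (a (Suc n)) (c (Suc n)) s ^ k"
proof -
  \<comment> \<open>Block \<open>0\<close> collects the variables that determine generation \<open>n\<close>; block \<open>i \<ge> 1\<close> is the
    single variable \<open>X (Suc n) i\<close>.\<close>
  define K where "K i = (if i = 0 then {1..n} \<times> {1..} else {(Suc n, i)})" for i :: nat
  \<comment> \<open>Here \<open>w\<close> is a table of counts indexed by generation and individual: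
    block \<open>0\<close> reruns the process on the table, every other block reads a single
    entry.\<close>
  define G where "G i w = (if i = 0 then indicator {k} (gwve (\<lambda>m j w. w (m, j)) n w)
      else s ^ w (Suc n, i))" for i :: nat and w :: "nat \<times> nat \<Rightarrow> nat"
  define R where "R i \<omega> = G i (restrict (\<lambda>z. (case z of (m, j) \<Rightarrow> X m j) \<omega>) (K i))" for i \<omega>
  have "indep_vars (\<lambda>i. PiM (K i) (\<lambda>_. count_space UNIV))
      (\<lambda>i \<omega>. restrict (\<lambda>z. (case z of (m, j) \<Rightarrow> X m j) \<omega>) (K i)) {0..k}"
    using indep by (rule indep_vars_restrict) (auto simp: K_def disjoint_family_on_def)
  moreover have "G i \<in> borel_measurable (PiM (K i) (\<lambda>_. count_space UNIV))" for i
  proof (cases "i = 0")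
    case True
    have "gwve (\<lambda>m j w. w (m, j)) n \<in> measurable (PiM (K 0) (\<lambda>_. count_space UNIV)) (count_space UNIV)"
      by (rule measurable_gwve) (auto simp: K_def intro!: measurable_component_singleton)
    then have "(\<lambda>w. indicator {k} (gwve (\<lambda>m j w. w (m, j)) n w) :: real)
        \<in> borel_measurable (PiM (K 0) (\<lambda>_. count_space UNIV))"
      by (rule measurable_compose) simp
    then show ?thesis using True unfolding G_def by simp
  next
    case False
    have "(\<lambda>w. w (Suc n, i)) \<in> measurable (PiM (K i) (\<lambda>_. count_space UNIV)) (count_space UNIV)"
      using False by (intro measurable_component_singleton) (auto simp: K_def)
    then have "(\<lambda>w. s ^ w (Suc n, i)) \<in> borel_measurable (PiM (K i) (\<lambda>_. count_space UNIV))"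
      by (rule measurable_compose) simp
    then show ?thesis using False unfolding G_def by simp
  qed
  ultimately have ind: "indep_vars (\<lambda>_. borel) R {0..k}"
    unfolding R_def by (rule indep_vars_compose2)
  \<comment> \<open>Restricting the table to \<open>K 0\<close> discards no entry on which
    generation \<open>n\<close> depends.\<close>
  have R0: "R 0 = (\<lambda>\<omega>. indicator {k} (gwve X n \<omega>))"
    unfolding R_def G_def
    by (auto simp: K_def intro!: arg_cong[where f = "indicator {k}"] gwve_cong)
  have RS: "R i = (\<lambda>\<omega>. s ^ X (Suc n) i \<omega>)" if "i \<ge> 1" for i
    using that by (auto simp: R_def G_def K_def)
  have int: "integrable M (R i)" for i
  proof (cases "i = 0")
    case True
    have "integrable M (\<lambda>\<omega>. indicator {k} (gwve X n \<omega>) :: real)"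
      by (intro integrable_const_bound[where B = 1]) (auto simp: indicator_def)
    then show ?thesis using True R0 by simp
  next
    case False
    then show ?thesis using RS integrable_power[OF X_measurable s, of "Suc n" i] by simp
  qed
  have split: "(\<Prod>i = 0..k. h i) = h 0 * (\<Prod>i = 1..k. h i)" for h :: "nat \<Rightarrow> real"
    by (simp add: prod.atLeast_Suc_atMost)
  have "expectation (\<lambda>\<omega>. indicator {k} (gwve X n \<omega>) * (\<Prod>i = 1..k. s ^ X (Suc n) i \<omega>))
      = expectation (\<lambda>\<omega>. \<Prod>i = 0..k. R i \<omega>)"
    unfolding split using R0 RS by simp
  also have "\<dots> = (\<Prod>i = 0..k. expectation (R i))"
    using ind int by (intro indep_vars_lebesgue_integral) auto
  also have "\<dots> = expectation (\<lambda>\<omega>. indicator {k} (gwve X n \<omega>))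
      * (\<Prod>i = 1..k. gw_theta_pgf \<theta> (a (Suc n)) (c (Suc n)) s)"
    unfolding split using R0 RS expectation_power_offspring[OF _ _ s, of "Suc n"] by simp
  finally show ?thesis by simp
qed

text \<open>Given \<open>k\<close> individuals in generation \<open>n\<close>, the mean of
  \<open>s ^ gwve X (Suc n)\<close> is \<open>t ^ k\<close>. Hence both sides are sums of the same
  series over \<open>k\<close>.\<close>

lemma expectation_power_gwve_Suc:
  fixes n :: nat
  assumes s: "0 \<le> s" "s \<le> 1"
  defines "t \<equiv> gw_theta_pgf \<theta> (a (Suc n)) (c (Suc n)) s"
  assumes t: "0 \<le> t" "t \<le> 1"
  shows "expectation (\<lambda>\<omega>. s ^ gwve X (Suc n) \<omega>) = expectation (\<lambda>\<omega>. t ^ gwve X n \<omega>)"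
proof -
  have "expectation (\<lambda>\<omega>. indicator {k} (gwve X n \<omega>) * s ^ gwve X (Suc n) \<omega>)
      = expectation (\<lambda>\<omega>. indicator {k} (gwve X n \<omega>) * t ^ gwve X n \<omega>)" for k
  proof -
    have "expectation (\<lambda>\<omega>. indicator {k} (gwve X n \<omega>) * s ^ gwve X (Suc n) \<omega>)
        = expectation (\<lambda>\<omega>. indicator {k} (gwve X n \<omega>) * (\<Prod>i = 1..k. s ^ X (Suc n) i \<omega>))"
      by (intro Bochner_Integration.integral_cong) (auto simp: indicator_def power_sum)
    also have "\<dots> = expectation (\<lambda>\<omega>. indicator {k} (gwve X n \<omega>) * t ^ k)"
      unfolding expectation_power_sum_on_gwve_eq[OF s] t_def by simp
    also have "\<dots> = expectation (\<lambda>\<omega>. indicator {k} (gwve X n \<omega>) * t ^ gwve X n \<omega>)"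
      by (intro Bochner_Integration.integral_cong) (auto simp: indicator_def)
    finally show ?thesis .
  qed
  then show ?thesis
    using integral_disintegrate_sums[OF integrable_power[OF gwve_measurable[of "Suc n"] s] gwve_measurable[of n]]
      integral_disintegrate_sums[OF integrable_power[OF gwve_measurable[of n] t] gwve_measurable[of n]]
    by (simp only: sums_unique2)
qed

lemma A_seq_pos: "0 < A_seq a n"
  unfolding A_seq_def by (rule prod_pos) (simp add: a_pos)

lemma C_seq_nonneg: "0 \<le> C_seq a c n"
  unfolding C_seq_def using A_seq_pos c_pos by (intro sum_nonneg mult_nonneg_nonneg) (auto intro: less_imp_le)

text \<open>The induction step trades generation \<open>Suc n\<close> for the new argument
  \<open>?t\<close>, so the hypothesis must hold for every \<open>s\<close>. The new map enters
  innermost, which is how \<open>A_seq_Suc\<close> and \<open>C_seq_Suc\<close> extend the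
  parameters; the parameters 1 and 0 at time 0 give the identity.\<close>

lemma expectation_power_gwve:
  assumes "0 \<le> s" "s < 1"
  shows "expectation (\<lambda>\<omega>. s ^ gwve X n \<omega>) = gw_theta_pgf \<theta> (A_seq a n) (C_seq a c n) s"
  using assms
proof (induction n arbitrary: s)
  case 0
  then show ?case using theta by (simp add: gw_theta_pgf_def powr_powr prob_space)
next
  case (Suc n)
  let ?t = "gw_theta_pgf \<theta> (a (Suc n)) (c (Suc n)) s"
  have t: "0 \<le> ?t" "?t < 1"
    using Suc.prems theta a_pos[of "Suc n"] c_pos[of "Suc n"] c_ge[of "Suc n"]
    by (auto intro!: gw_theta_pgf_nonneg gw_theta_pgf_less_1)
  have "expectation (\<lambda>\<omega>. s ^ gwve X (Suc n) \<omega>) = gw_theta_pgf \<theta> (A_seq a n) (C_seq a c n) ?t"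
    using Suc t by (subst expectation_power_gwve_Suc) auto
  then show ?case
    using Suc.prems theta a_pos[of "Suc n"] c_pos[of "Suc n"]
    by (simp add: gw_theta_pgf_comp A_seq_Suc C_seq_Suc del: gwve.simps)
qed

section \<open>Extinction probability, mean and Laplace transform at time \<open>n\<close>\<close>

lemma prob_gwve_eq_0:
  "\<P>(\<omega> in M. gwve X n \<omega> = 0) = 1 - (A_seq a n + C_seq a c n) powr (-(1 / \<theta>))"
proof -
  have "\<P>(\<omega> in M. gwve X n \<omega> = 0) = expectation (indicator {\<omega> \<in> space M. gwve X n \<omega> = 0})"
    by simp
  \<comment> \<open>Since \<open>0 ^ 0 = 1\<close>, the power of 0 is the indicator of
    extinction.\<close>
  also have "\<dots> = expectation (\<lambda>\<omega>. 0 ^ gwve X n \<omega>)"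
    by (intro Bochner_Integration.integral_cong) (auto simp: indicator_def)
  finally show ?thesis
    using expectation_power_gwve[of 0 n] by (simp add: gw_theta_pgf_def)
qed

lemma prob_gwve_pos:
  "\<P>(\<omega> in M. gwve X n \<omega> > 0) = (A_seq a n + C_seq a c n) powr (-(1 / \<theta>))"
proof -
  have "{\<omega> \<in> space M. gwve X n \<omega> > 0} = space M - {\<omega> \<in> space M. gwve X n \<omega> = 0}" by auto
  then show ?thesis using prob_gwve_eq_0[of n] by (simp add: prob_compl)
qed

lemma prob_gwve_pos_gt_0: "\<P>(\<omega> in M. gwve X n \<omega> > 0) > 0"
  using A_seq_pos[of n] C_seq_nonneg[of n] by (simp add: prob_gwve_pos)

text \<open>Monotone convergence, since \<open>(1 - s ^ k) / (1 - s)\<close> increases to \<open>k\<close> as \<open>s\<close> increases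
  to \<open>1\<close>.\<close>

lemma expectation_gwve: "expectation (\<lambda>\<omega>. real (gwve X n \<omega>)) = A_seq a n powr (-(1 / \<theta>))"
proof -
  \<comment> \<open>These points increase from 0 to 1 but stay below 1, where the closed form of the
    generating function is available.\<close>
  define s where "s m = 1 - 1 / (real m + 1)" for m :: nat
  \<comment> \<open>As a geometric sum, the difference quotient is visibly monotone in
    \<open>m\<close> and tends termwise to \<open>k\<close>.\<close>
  define h where "h m k = (\<Sum>j<k. s m ^ j)" for m k :: nat
  have s: "0 \<le> s m" "s m < 1" for m by (auto simp: s_def field_simps)
  have s_mono: "s m \<le> s m'" if "m \<le> m'" for m m'
    using that by (simp add: s_def frac_le)
  have s_lim: "s \<longlonglongrightarrow> 1" unfolding s_def by real_asymp
  have h_eq: "h m k = (1 - s m ^ k) / (1 - s m)" for m k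
    using s[of m] by (simp add: h_def sum_gp_strict)
  have int: "integrable M (\<lambda>\<omega>. h m (gwve X n \<omega>))" for m
    unfolding h_eq using integrable_power[OF gwve_measurable, of "s m" n] s[of m] by simp
  have Eh: "expectation (\<lambda>\<omega>. h m (gwve X n \<omega>))
      = (A_seq a n + C_seq a c n * (1 - s m) powr \<theta>) powr (-(1 / \<theta>))" for m
  proof -
    let ?x = "1 - s m" and ?A = "A_seq a n" and ?C = "C_seq a c n"
    have x: "?x > 0" using s[of m] by simp
    have "expectation (\<lambda>\<omega>. h m (gwve X n \<omega>)) = (?A * ?x powr (-\<theta>) + ?C) powr (-(1/\<theta>)) / ?x"
      unfolding h_eq
      using integrable_power[OF gwve_measurable, of "s m" n] s[of m] expectation_power_gwve[of "s m" n]
      by (simp add: gw_theta_pgf_def prob_space)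
    \<comment> \<open>The factor taken out becomes \<open>?x\<close> under the power
      \<open>-1/\<theta>\<close> and cancels the denominator.\<close>
    also have "?A * ?x powr (-\<theta>) + ?C = (?A + ?C * ?x powr \<theta>) * ?x powr (-\<theta>)"
      using x by (simp add: distrib_right mult.assoc flip: powr_add)
    also have "\<dots> powr (-(1/\<theta>)) = (?A + ?C * ?x powr \<theta>) powr (-(1/\<theta>)) * ?x"
      using x theta A_seq_pos[of n] C_seq_nonneg[of n] by (subst powr_mult) (auto simp: powr_powr)
    finally show ?thesis using x by simp
  qed
  show ?thesis
  proof (rule integral_monotone_convergence[where f = "\<lambda>m \<omega>. h m (gwve X n \<omega>)", OF int])
    show "AE \<omega> in M. mono (\<lambda>m. h m (gwve X n \<omega>))"
      using s s_mono by (auto simp: h_def mono_def intro!: sum_mono power_mono)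
    show "AE \<omega> in M. (\<lambda>m. h m (gwve X n \<omega>)) \<longlonglongrightarrow> real (gwve X n \<omega>)"
    proof (rule AE_I2)
      fix \<omega>
      have "(\<lambda>m. h m (gwve X n \<omega>)) \<longlonglongrightarrow> (\<Sum>j<gwve X n \<omega>. 1 ^ j)"
        unfolding h_def by (intro tendsto_intros s_lim)
      then show "(\<lambda>m. h m (gwve X n \<omega>)) \<longlonglongrightarrow> real (gwve X n \<omega>)" by simp
    qed
    \<comment> \<open>The contribution of \<open>C_seq\<close> disappears in the limit, so the mean
      depends on \<open>A_seq\<close> alone.\<close>
    have "(\<lambda>m. (1 - s m) powr \<theta>) \<longlonglongrightarrow> 0"
      using theta s s_lim
      by (intro tendsto_zero_powrI[where b = \<theta>] tendsto_eq_intros | simp add: less_imp_le)+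
    then have "(\<lambda>m. (A_seq a n + C_seq a c n * (1 - s m) powr \<theta>) powr (-(1 / \<theta>)))
        \<longlonglongrightarrow> (A_seq a n + C_seq a c n * 0) powr (-(1 / \<theta>))"
      using A_seq_pos[of n] by (intro tendsto_intros) auto
    then show "(\<lambda>m. expectation (\<lambda>\<omega>. h m (gwve X n \<omega>))) \<longlonglongrightarrow> A_seq a n powr (-(1 / \<theta>))"
      by (simp add: Eh)
  qed simp
qed

text \<open>The population size vanishes off the event, so the restricted integral is the full mean;
  dividing by the survival probability leaves a power of
  \<open>(A_seq a n + C_seq a c n) / A_seq a n\<close>.\<close>

lemma cond_expectation_gwve:
  "cond_expectation M (\<lambda>\<omega>. real (gwve X n \<omega>)) {\<omega> \<in> space M. gwve X n \<omega> > 0}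
    = (1 + B_seq a c n) powr (1 / \<theta>)"
proof -
  let ?A = "A_seq a n" and ?C = "C_seq a c n"
  have pos: "?A > 0" "?C \<ge> 0" by (rule A_seq_pos, rule C_seq_nonneg)
  have "(LINT \<omega>:{\<omega> \<in> space M. gwve X n \<omega> > 0}|M. real (gwve X n \<omega>)) = expectation (\<lambda>\<omega>. real (gwve X n \<omega>))"
    unfolding set_lebesgue_integral_def
    by (intro Bochner_Integration.integral_cong) (auto simp: indicator_def)
  then have "cond_expectation M (\<lambda>\<omega>. real (gwve X n \<omega>)) {\<omega> \<in> space M. gwve X n \<omega> > 0}
      = ?A powr (-(1/\<theta>)) / (?A + ?C) powr (-(1/\<theta>))"
    by (simp add: cond_expectation_def expectation_gwve prob_gwve_pos)
  also have "\<dots> = ((?A + ?C) / ?A) powr (1 / \<theta>)"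
    using pos by (simp add: powr_divide powr_minus field_simps)
  also have "(?A + ?C) / ?A = 1 + B_seq a c n"
    using pos by (simp add: B_seq_def field_simps)
  finally show ?thesis .
qed

lemma cond_expectation_exp_gwve:
  assumes "0 < v"
  shows "cond_expectation M (\<lambda>\<omega>. exp (- v * real (gwve X n \<omega>))) {\<omega> \<in> space M. gwve X n \<omega> > 0}
    = 1 - (((1 - exp (-v)) powr (-\<theta>) + B_seq a c n) / (1 + B_seq a c n)) powr (-(1 / \<theta>))"
proof -
  let ?A = "A_seq a n" and ?C = "C_seq a c n" and ?x = "(1 - exp (-v)) powr (-\<theta>)"
  have pos: "?A > 0" "?C \<ge> 0" by (rule A_seq_pos, rule C_seq_nonneg)
  have x: "?x > 0" using assms by simp
  have E: "exp (- v * real k) = exp (-v) ^ k" for k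
    by (simp add: exp_of_nat_mult[symmetric] mult.commute)
  \<comment> \<open>Subtracting \<open>0 ^ gwve X n \<omega>\<close> removes the value 1 on
    extinction and changes nothing on survival.\<close>
  have "(LINT \<omega>:{\<omega> \<in> space M. gwve X n \<omega> > 0}|M. exp (- v * real (gwve X n \<omega>)))
      = expectation (\<lambda>\<omega>. exp (-v) ^ gwve X n \<omega> - 0 ^ gwve X n \<omega>)"
    unfolding set_lebesgue_integral_def E
    by (intro Bochner_Integration.integral_cong) (auto simp: indicator_def)
  also have "\<dots> = (?A + ?C) powr (-(1/\<theta>)) - (?A * ?x + ?C) powr (-(1/\<theta>))"
    using assms integrable_power[OF gwve_measurable, of "exp (-v)" n] integrable_power[OF gwve_measurable, of 0 n]
      expectation_power_gwve[of "exp (-v)" n] expectation_power_gwve[of 0 n]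
    by (simp add: gw_theta_pgf_def)
  finally have "cond_expectation M (\<lambda>\<omega>. exp (- v * real (gwve X n \<omega>))) {\<omega> \<in> space M. gwve X n \<omega> > 0}
      = 1 - (?A * ?x + ?C) powr (-(1/\<theta>)) / (?A + ?C) powr (-(1/\<theta>))"
    using pos by (simp add: cond_expectation_def prob_gwve_pos diff_divide_distrib)
  also have "(?A * ?x + ?C) powr (-(1/\<theta>)) / (?A + ?C) powr (-(1/\<theta>))
      = ((?A * ?x + ?C) / (?A + ?C)) powr (-(1/\<theta>))"
    using pos x by (simp add: powr_divide)
  also have "(?A * ?x + ?C) / (?A + ?C) = (?x + B_seq a c n) / (1 + B_seq a c n)"
    using pos by (simp add: B_seq_def divide_simps)
  finally show ?thesis .
qed

end

section \<open>Asymptotics\<close>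

text \<open>The quotients in the survival and mean asymptotics are exactly of this form, with
  exponents \<open>-1/\<theta>\<close> and \<open>1/\<theta>\<close>.\<close>

lemma tendsto_one_plus_inverse_powr:
  fixes B :: "nat \<Rightarrow> real"
  assumes "filterlim B at_top sequentially"
  shows "(\<lambda>n. (1 + 1 / B n) powr e) \<longlonglongrightarrow> 1"
proof -
  have "(\<lambda>n. 1 / B n) \<longlonglongrightarrow> 0"
    using tendsto_inverse_0_at_top[OF assms] by (simp add: inverse_eq_divide)
  then have "(\<lambda>n. (1 + 1 / B n) powr e) \<longlonglongrightarrow> (1 + 0) powr e"
    by (intro tendsto_intros) auto
  then show ?thesis by simp
qed

text \<open>As \<open>1 - exp (-y)\<close> is asymptotic to \<open>y\<close> at 0, inserting
  \<open>y = u * B n powr (-(1 / \<theta>))\<close> and raising to \<open>-\<theta>\<close> gives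
  \<open>u powr (-\<theta>) * B n\<close> to leading order.\<close>

lemma tendsto_one_minus_exp_powr:
  fixes B :: "nat \<Rightarrow> real"
  assumes "filterlim B at_top sequentially" "0 < \<theta>" "0 < u"
  shows "(\<lambda>n. (1 - exp (-(u * B n powr (-(1 / \<theta>))))) powr (-\<theta>) / B n) \<longlonglongrightarrow> u powr (-\<theta>)"
proof -
  define y where "y n = u * B n powr (-(1 / \<theta>))" for n
  have ev: "\<forall>\<^sub>F n in sequentially. B n > 0"
    using assms(1) by (simp add: filterlim_at_top_dense)
  have "(\<lambda>n. B n powr (-(1 / \<theta>))) \<longlonglongrightarrow> 0"
    using assms by (intro tendsto_neg_powr) auto
  then have "y \<longlonglongrightarrow> 0" unfolding y_def using tendsto_mult_right_zero by blast
  moreover have "\<forall>\<^sub>F n in sequentially. y n \<in> {0<..} \<and> y n \<noteq> 0"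
    using ev by eventually_elim (use assms in \<open>auto simp: y_def\<close>)
  ultimately have "filterlim y (at_right 0) sequentially" by (simp add: filterlim_at)
  moreover have "((\<lambda>y::real. (1 - exp (-y)) / y) \<longlongrightarrow> 1) (at_right 0)" by real_asymp
  ultimately have "(\<lambda>n. (1 - exp (- y n)) / y n) \<longlonglongrightarrow> 1"
    by (rule filterlim_compose[rotated])
  then have "(\<lambda>n. (u * ((1 - exp (- y n)) / y n)) powr (-\<theta>)) \<longlonglongrightarrow> (u * 1) powr (-\<theta>)"
    using assms by (intro tendsto_intros) auto
  moreover have "\<forall>\<^sub>F n in sequentially. (u * ((1 - exp (- y n)) / y n)) powr (-\<theta>)
      = (1 - exp (-(u * B n powr (-(1 / \<theta>))))) powr (-\<theta>) / B n"
    using ev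
  proof eventually_elim
    case (elim n)
    then have y: "y n > 0" using assms by (simp add: y_def)
    \<comment> \<open>This identity turns the factor \<open>u / y n\<close> into a power of
      \<open>B n\<close> that becomes \<open>1 / B n\<close> under the exponent
      \<open>-\<theta>\<close>.\<close>
    have "u / y n = B n powr (1 / \<theta>)" using elim assms by (simp add: y_def powr_minus field_simps)
    then have "u * ((1 - exp (- y n)) / y n) = (1 - exp (- y n)) * B n powr (1 / \<theta>)"
      by (metis times_divide_eq_left times_divide_eq_right mult.commute)
    then have "(u * ((1 - exp (- y n)) / y n)) powr (-\<theta>)
        = ((1 - exp (- y n)) * B n powr (1 / \<theta>)) powr (-\<theta>)"
      by simp
    also have "\<dots> = (1 - exp (- y n)) powr (-\<theta>) * B n powr (-1)"
      using y elim assms by (subst powr_mult) (auto simp: powr_powr)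
    finally show ?case using elim by (simp add: y_def powr_minus divide_inverse)
  qed
  ultimately show ?thesis by (simp add: Lim_transform_eventually)
qed

theorem theorem3:
  fixes M :: "'w measure" and \<theta> :: real and a c :: "nat \<Rightarrow> real"
    and p :: "nat \<Rightarrow> nat \<Rightarrow> real" and X :: "nat \<Rightarrow> nat \<Rightarrow> 'w \<Rightarrow> nat"
    and Z :: "nat \<Rightarrow> 'w \<Rightarrow> nat"
  assumes "gw_theta_process M \<theta> a c p X"
    and "Z = gwve X"
    and "filterlim (C_seq a c) at_top sequentially"
    and "filterlim (B_seq a c) at_top sequentially"
  shows "(\<lambda>n. \<P>(\<omega> in M. Z n \<omega> = 0)) \<longlonglongrightarrow> 1
    \<and> (\<lambda>n. \<P>(\<omega> in M. Z n \<omega> > 0)) \<sim>[sequentially] (\<lambda>n. C_seq a c n powr (-(1 / \<theta>)))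
    \<and> (\<lambda>n. cond_expectation M (\<lambda>\<omega>. real (Z n \<omega>)) {\<omega> \<in> space M. Z n \<omega> > 0})
        \<sim>[sequentially] (\<lambda>n. B_seq a c n powr (1 / \<theta>))
    \<and> (\<forall>u\<ge>0. (\<lambda>n. cond_expectation M
              (\<lambda>\<omega>. exp (-(u * B_seq a c n powr (-(1 / \<theta>))) * real (Z n \<omega>)))
              {\<omega> \<in> space M. Z n \<omega> > 0})
          \<longlonglongrightarrow> limit_laplace \<theta> u)"
proof -
  interpret gw_theta_process M \<theta> a c p X by fact
  note Z = assms(2) and C = assms(3) and B = assms(4)
  let ?A = "A_seq a" and ?B = "B_seq a c" and ?C = "C_seq a c"
  have Bpos: "\<forall>\<^sub>F n in sequentially. ?B n > 0"
    using B by (simp add: filterlim_at_top_dense)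
  \<comment> \<open>Restricting to \<open>?B n > 0\<close> excludes \<open>n = 0\<close>, where
    \<open>?C\<close> is 0 and cannot serve as a divisor.\<close>
  have Cpos: "?C n > 0" if "?B n > 0" for n
    using that A_seq_pos[of n] by (simp add: B_seq_def zero_less_divide_iff)

  have "filterlim (\<lambda>n. ?A n + ?C n) at_top sequentially"
    by (rule filterlim_at_top_mono[OF C]) (simp add: A_seq_pos less_imp_le)
  then have "(\<lambda>n. (?A n + ?C n) powr (-(1 / \<theta>))) \<longlonglongrightarrow> 0"
    using theta by (intro tendsto_neg_powr) auto
  from tendsto_diff[OF tendsto_const[of 1] this]
  have extinction: "(\<lambda>n. \<P>(\<omega> in M. Z n \<omega> = 0)) \<longlonglongrightarrow> 1"
    by (simp add: Z prob_gwve_eq_0)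

  have survival: "(\<lambda>n. \<P>(\<omega> in M. Z n \<omega> > 0)) \<sim>[sequentially] (\<lambda>n. ?C n powr (-(1 / \<theta>)))"
  proof (rule asymp_equivI', rule Lim_transform_eventually[OF tendsto_one_plus_inverse_powr[OF B]])
    show "\<forall>\<^sub>F n in sequentially. (1 + 1 / ?B n) powr (-(1 / \<theta>))
        = \<P>(\<omega> in M. Z n \<omega> > 0) / ?C n powr (-(1 / \<theta>))"
      using Bpos
    proof eventually_elim
      case (elim n)
      have "1 + 1 / ?B n = (?A n + ?C n) / ?C n"
        using Cpos[OF elim] by (simp add: B_seq_def field_simps)
      then show ?case
        using Cpos[OF elim] A_seq_pos[of n] by (simp add: Z prob_gwve_pos powr_divide)
    qed
  qed

  have mean: "(\<lambda>n. cond_expectation M (\<lambda>\<omega>. real (Z n \<omega>)) {\<omega> \<in> space M. Z n \<omega> > 0})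
      \<sim>[sequentially] (\<lambda>n. ?B n powr (1 / \<theta>))"
  proof (rule asymp_equivI', rule Lim_transform_eventually[OF tendsto_one_plus_inverse_powr[OF B]])
    show "\<forall>\<^sub>F n in sequentially. (1 + 1 / ?B n) powr (1 / \<theta>)
        = cond_expectation M (\<lambda>\<omega>. real (Z n \<omega>)) {\<omega> \<in> space M. Z n \<omega> > 0} / ?B n powr (1 / \<theta>)"
      using Bpos
    proof eventually_elim
      case (elim n)
      have "1 + 1 / ?B n = (1 + ?B n) / ?B n" using elim by (simp add: field_simps)
      then show ?case using elim by (simp add: Z cond_expectation_gwve powr_divide)
    qed
  qed

  have laplace: "(\<lambda>n. cond_expectation M
          (\<lambda>\<omega>. exp (-(u * ?B n powr (-(1 / \<theta>))) * real (Z n \<omega>))) {\<omega> \<in> space M. Z n \<omega> > 0})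
      \<longlonglongrightarrow> limit_laplace \<theta> u" if "u \<ge> 0" for u
  proof (cases "u = 0")
    case True
    \<comment> \<open>At \<open>u = 0\<close> the integrand is constantly 1. The general formula
      would involve \<open>0 powr (-\<theta>)\<close>, which evaluates to 0 instead of
      infinity.\<close>
    have "(LINT \<omega>:{\<omega> \<in> space M. Z n \<omega> > 0}|M. (1::real)) = \<P>(\<omega> in M. Z n \<omega> > 0)" for n
      by (simp add: set_lebesgue_integral_def Z)
    then have "cond_expectation M (\<lambda>\<omega>. 1) {\<omega> \<in> space M. Z n \<omega> > 0} = 1" for n
      using prob_gwve_pos_gt_0[of n] by (simp add: cond_expectation_def Z)
    then show ?thesis using True by (simp add: limit_laplace_def)
  next
    case False
    with that have u: "u > 0" by simp
    define x where "x n = (1 - exp (-(u * ?B n powr (-(1 / \<theta>))))) powr (-\<theta>)" for n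
    have xB: "(\<lambda>n. x n / ?B n) \<longlonglongrightarrow> u powr (-\<theta>)"
      unfolding x_def using B theta u by (intro tendsto_one_minus_exp_powr)
    have iB: "(\<lambda>n. 1 / ?B n) \<longlonglongrightarrow> 0"
      using tendsto_inverse_0_at_top[OF B] by (simp add: inverse_eq_divide)
    \<comment> \<open>Numerator and denominator are divided by \<open>?B n\<close>, since
      \<open>x n\<close> itself grows like \<open>?B n\<close> and only the ratio has a finite
      limit.\<close>
    have "(\<lambda>n. 1 - ((1 + x n / ?B n) / (1 + 1 / ?B n)) powr (-(1 / \<theta>)))
        \<longlonglongrightarrow> 1 - ((1 + u powr (-\<theta>)) / (1 + 0)) powr (-(1 / \<theta>))"
      using add_pos_pos[of 1 "u powr (-\<theta>)"] u by (intro tendsto_intros xB iB) auto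
    moreover have "\<forall>\<^sub>F n in sequentially. 1 - ((1 + x n / ?B n) / (1 + 1 / ?B n)) powr (-(1 / \<theta>))
        = cond_expectation M (\<lambda>\<omega>. exp (-(u * ?B n powr (-(1 / \<theta>))) * real (Z n \<omega>)))
            {\<omega> \<in> space M. Z n \<omega> > 0}"
      using Bpos
    proof eventually_elim
      case (elim n)
      have "(1 + x n / ?B n) / (1 + 1 / ?B n) = (x n + ?B n) / (1 + ?B n)"
        using elim by (simp add: divide_simps) (simp add: algebra_simps)
      then show ?case
        using elim u cond_expectation_exp_gwve[of "u * ?B n powr (-(1 / \<theta>))" n]
        by (simp add: Z x_def)
    qed
    ultimately show ?thesis
      using u by (auto simp: limit_laplace_def intro: Lim_transform_eventually)
  qed

  show ?thesis using extinction survival mean laplace by blast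
qed

end
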